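(* Let $p$ be a prime and $w\ge1$ an integer. Then the number of Scopes families is $\frac1p\binom{pw}{p-1}$.
   Context: Let $\mathscr C_p=\{(c_0,\ldots,c_{p-1})\in\mathbb Z^p:\sum c_j=0\}$. For $1\le j\le p-1$, $c\in\mathscr C_p$ is $j$-allowed if $c_j-c_{j-1}\ge w$, and then $\mathrm{sc}_j(c)$ is $c$ with coordinates $c_{j-1}$ and $c_j$ interchanged. $c$ is $0$-allowed if $c_0-c_{p-1}>w$, and then $\mathrm{sc}_0(c)=(c_{p-1}+1,c_1,\ldots,c_{p-2},c_0-1)$. The Scopes families (for $p$ and $w$) are the equivalence classes of the equivalence relation on $\mathscr C_p$ generated by $c\sim\mathrm{sc}_j(c)$ for all $0\le j\le p-1$ and all $j$-allowed $c$. (Here $\mathscr C_p$ parametrizes $p$-core partitions, and Scopes families correspond to classes of $p$-blocks of symmetric groups of weight $w$.) *)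

theory Defs
  imports Complex_Main "HOL-Computational_Algebra.Primes"
begin

definition cvecs :: "nat \<Rightarrow> int list set" where
  "cvecs p = {c. length c = p \<and> sum_list c = 0}"

definition allowed :: "nat \<Rightarrow> nat \<Rightarrow> nat \<Rightarrow> int list \<Rightarrow> bool" where
  "allowed p w j c \<longleftrightarrow>
     (if j = 0 then c ! 0 - c ! (p - 1) > int w else c ! j - c ! (j - 1) \<ge> int w)"

definition sc :: "nat \<Rightarrow> nat \<Rightarrow> int list \<Rightarrow> int list" where
  "sc p j c =
     (if j = 0 then c[0 := c ! (p - 1) + 1, p - 1 := c ! 0 - 1]
      else c[j - 1 := c ! j, j := c ! (j - 1)])"

definition scopes_step :: "nat \<Rightarrow> nat \<Rightarrow> int list \<Rightarrow> int list \<Rightarrow> bool" where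
  "scopes_step p w c d \<longleftrightarrow> c \<in> cvecs p \<and> (\<exists>j<p. allowed p w j c \<and> d = sc p j c)"

definition scopes_equiv :: "nat \<Rightarrow> nat \<Rightarrow> (int list \<times> int list) set" where
  "scopes_equiv p w =
     {(c, d). c \<in> cvecs p \<and> d \<in> cvecs p \<and> equivclp (scopes_step p w) c d}"

definition scopes_families :: "nat \<Rightarrow> nat \<Rightarrow> int list set set" where
  "scopes_families p w = cvecs p // scopes_equiv p w"

lemma equiv_scopes_equiv: "equiv (cvecs p) (scopes_equiv p w)"
  unfolding scopes_equiv_def
  by (rule equivI)
    (auto simp: refl_on_def sym_def trans_def intro: equivclp_sym equivclp_trans)

lemma sum_list_update_int:
  "k < length xs \<Longrightarrow> sum_list (xs[k := x]) = sum_list xs + x - xs ! k" for x :: int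
  by (induction xs arbitrary: k) (auto split: nat.split)

lemma sc_in_cvecs:
  assumes "c \<in> cvecs p" "2 \<le> p" "j < p"
  shows "sc p j c \<in> cvecs p"
  using assms
  by (cases "j = 0") (auto simp: cvecs_def sc_def sum_list_update_int nth_list_update)

end

theory Submission imports Defs begin

text \<open>
  Orient every relation \<open>c \<sim> sc\<^sub>j(c)\<close> as a rewrite step \<open>c \<rightarrow> sc\<^sub>j(c)\<close>. The steps terminate,
  since they decrease \<open>\<Sum>\<^sub>i (p c\<^sub>i + i)\<^sup>2\<close>, and they are locally confluent: steps at non-adjacent
  indices commute, and steps at adjacent indices satisfy the braid relation. By Newman's lemma
  every Scopes family contains exactly one irreducible vector. Dropping the condition
  \<open>\<Sum> c\<^sub>i = 0\<close>, the slacks in the inequalities defining irreducibility are arbitrary natural numbers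
  \<open>e\<^sub>0, \<dots>, e\<^sub>p\<^sub>-\<^sub>1\<close> with sum \<open>p(w - 1) + 1\<close>; they determine \<open>c\<close> up to adding a constant vector, so
  there are \<open>pw choose (p - 1)\<close> irreducible vectors with \<open>0 \<le> \<Sum> c\<^sub>i < p\<close>. The cyclic shift
  \<open>c \<mapsto> (c\<^sub>p\<^sub>-\<^sub>1 + 1, c\<^sub>0, \<dots>, c\<^sub>p\<^sub>-\<^sub>2)\<close> preserves irreducibility and raises the sum by one, so the \<open>p\<close>
  values of the sum are equally frequent.
\<close>

section \<open>Terminating locally confluent relations\<close>

definition normal_form :: "('a \<Rightarrow> 'a \<Rightarrow> bool) \<Rightarrow> 'a \<Rightarrow> bool" where
  "normal_form r x \<longleftrightarrow> (\<nexists>y. r x y)"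

text \<open>Newman's lemma by induction on the measure \<open>m\<close>. If \<open>x\<close> steps
  to \<open>y\<close> and to \<open>z\<close>, local confluence gives a common reduct
  \<open>u\<close>. A normal form of \<open>u\<close> is then one of both \<open>y\<close> and
  \<open>z\<close>, so by the induction hypothesis the normal forms reached through \<open>y\<close>
  and through \<open>z\<close> agree.\<close>

lemma newman_unique_normal_form:
  assumes dec: "\<And>x y. r x y \<Longrightarrow> m y < (m x :: nat)"
    and peak: "\<And>x y z. r x y \<Longrightarrow> r x z \<Longrightarrow> \<exists>u. r\<^sup>*\<^sup>* y u \<and> r\<^sup>*\<^sup>* z u"
  shows "\<exists>!n. r\<^sup>*\<^sup>* x n \<and> normal_form r n"
proof (induction "m x" arbitrary: x rule: less_induct)
  case less
  show ?case
  proof (cases "normal_form r x")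
    case True
    then show ?thesis
      unfolding normal_form_def by (metis converse_rtranclpE rtranclp.rtrancl_refl)
  next
    case False
    then obtain y where y: "r x y" by (auto simp: normal_form_def)
    obtain n where n: "r\<^sup>*\<^sup>* y n" "normal_form r n"
      and n_unique: "\<And>n'. r\<^sup>*\<^sup>* y n' \<Longrightarrow> normal_form r n' \<Longrightarrow> n' = n"
      using less[OF dec[OF y]] by blast
    have "n' = n" if n': "r\<^sup>*\<^sup>* x n'" "normal_form r n'" for n'
    proof -
      obtain z where z: "r x z" "r\<^sup>*\<^sup>* z n'"
        using n' False by (metis converse_rtranclpE)
      obtain u where u: "r\<^sup>*\<^sup>* y u" "r\<^sup>*\<^sup>* z u" using peak[OF y z(1)] by blast
      \<comment> \<open>Puts \<open>u\<close> within reach of the induction hypothesis, which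
        provides the normal form \<open>v\<close> of \<open>u\<close>.\<close>
      have "m u < m x"
      proof -
        have "r\<^sup>*\<^sup>* a b \<Longrightarrow> m b \<le> m a" for a b
          by (induction rule: rtranclp_induct) (auto dest!: dec)
        then show ?thesis using u(1) dec[OF y] by fastforce
      qed
      then obtain v where v: "r\<^sup>*\<^sup>* u v" "normal_form r v" using less by blast
      have "v = n" using n_unique v u(1) by (meson rtranclp_trans)
      moreover have "v = n'" using less[OF dec[OF z(1)]] z(2) n'(2) v rtranclp_trans[OF u(2) v(1)] by blast
      ultimately show ?thesis by simp
    qed
    then show ?thesis using n y by (metis converse_rtranclp_into_rtranclp)
  qed
qed

text \<open>The map \<open>nf\<close> to the unique normal form is unchanged by a step in either
  direction, hence constant on equivalence classes, and it fixes normal forms.\<close>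

lemma newman_equivclp_normal_forms:
  assumes dec: "\<And>x y. r x y \<Longrightarrow> m y < (m x :: nat)"
    and peak: "\<And>x y z. r x y \<Longrightarrow> r x z \<Longrightarrow> \<exists>u. r\<^sup>*\<^sup>* y u \<and> r\<^sup>*\<^sup>* z u"
    and "equivclp r x y" "normal_form r x" "normal_form r y"
  shows "x = y"
proof -
  define nf where "nf a = (THE n. r\<^sup>*\<^sup>* a n \<and> normal_form r n)" for a
  have ex1: "\<exists>!n. r\<^sup>*\<^sup>* a n \<and> normal_form r n" for a
    by (rule newman_unique_normal_form[of r m]) (use dec peak in blast)+
  have nf: "r\<^sup>*\<^sup>* a (nf a) \<and> normal_form r (nf a)" for a
    unfolding nf_def by (rule theI'[OF ex1])
  have nf_eq: "nf a = b" if "r\<^sup>*\<^sup>* a b" "normal_form r b" for a b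
    using ex1[of a] nf[of a] that by blast
  have step: "nf a = nf b" if "r a b" for a b
    using nf_eq[of a "nf b"] nf[of b] that by (metis converse_rtranclp_into_rtranclp)
  have "nf x = nf y" using assms(3)
    by (induction rule: equivclp_induct) (auto dest: step)
  then show ?thesis using assms(4,5) nf_eq by (metis rtranclp.rtrancl_refl)
qed

section \<open>The Scopes moves as a rewriting system\<close>

definition cpred :: "nat \<Rightarrow> nat \<Rightarrow> nat" where
  "cpred p j = (if j = 0 then p - 1 else j - 1)"

text \<open>With the convention c_{-1} = c_{p-1} + 1, the move at 0 becomes an interchange of
  neighbours and its strict inequality the same weak one as elsewhere. Thus \<open>cpred\<close> and
  \<open>wrap\<close> give one formula for all indices.\<close>

definition wrap :: "nat \<Rightarrow> int" where
  "wrap j = (if j = 0 then 1 else 0)"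

lemma cpred_less: "j < p \<Longrightarrow> cpred p j < p"
  by (auto simp: cpred_def)

lemma cpred_neq: "2 \<le> p \<Longrightarrow> j < p \<Longrightarrow> cpred p j \<noteq> j"
  by (auto simp: cpred_def)

lemma cpred_eq_iff: "j < p \<Longrightarrow> k < p \<Longrightarrow> cpred p j = cpred p k \<longleftrightarrow> j = k"
  by (auto simp: cpred_def)

lemma allowed_iff:
  "allowed p w j c \<longleftrightarrow> c ! j - c ! cpred p j - wrap j \<ge> int w"
  by (auto simp: allowed_def cpred_def wrap_def)

lemma length_sc [simp]: "length (sc p j c) = length c"
  by (simp add: sc_def)

lemma nth_sc:
  assumes "2 \<le> p" "length c = p" "j < p" "i < p"
  shows "sc p j c ! i =
    (if i = j then c ! cpred p j + wrap j
     else if i = cpred p j then c ! j - wrap j else c ! i)"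
  using assms by (auto simp: sc_def cpred_def wrap_def nth_list_update)

definition potential :: "nat \<Rightarrow> int list \<Rightarrow> nat" where
  "potential p c = nat (\<Sum>i<p. (int p * c ! i + int i)\<^sup>2)"

text \<open>In the coordinates \<open>x\<^sub>i = p c\<^sub>i + i\<close> every move replaces the pair \<open>x\<^sub>j, x\<^sub>i\<close>, where
  \<open>i\<close> precedes \<open>j\<close> cyclically, by \<open>x\<^sub>i + 1, x\<^sub>j - 1\<close>, and it is allowed iff \<open>x\<^sub>j - x\<^sub>i > p w\<close>.\<close>

lemma potential_sc_less:
  assumes p: "2 \<le> p" and w: "1 \<le> w" and len: "length c = p" and j: "j < p"
    and allowed: "allowed p w j c"
  shows "potential p (sc p j c) < potential p c"
proof -
  define i where "i = cpred p j"
  define x where "x c i = int p * c ! i + int i" for c :: "int list" and i :: nat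
  have i: "i < p" "i \<noteq> j" using p j cpred_less cpred_neq by (auto simp: i_def)
  have split: "(\<Sum>k<p. (x d k)\<^sup>2) = (x d i)\<^sup>2 + ((x d j)\<^sup>2 + (\<Sum>k\<in>{..<p} - {i} - {j}. (x d k)\<^sup>2))" for d
    using i j by (subst sum.remove[of _ i], simp, simp) (subst sum.remove[of _ j], auto)
  have ij: "int j - int i = 1 - int p * wrap j"
    using j p by (auto simp: i_def cpred_def wrap_def)
  have xj: "x (sc p j c) j = x c i + 1"
    using ij by (simp add: x_def nth_sc p len j i_def[symmetric] algebra_simps)
  have xi: "x (sc p j c) i = x c j - 1"
    using ij i by (simp add: x_def nth_sc p len j i_def[symmetric] algebra_simps)
  have rest: "(\<Sum>k\<in>{..<p} - {i} - {j}. (x (sc p j c) k)\<^sup>2) = (\<Sum>k\<in>{..<p} - {i} - {j}. (x c k)\<^sup>2)"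
    by (rule sum.cong) (auto simp: x_def nth_sc p len j i_def[symmetric])
  have "x c j - x c i = int p * (c ! j - c ! i - wrap j) + 1"
    using ij by (simp add: x_def algebra_simps)
  moreover have "int p * 1 \<le> int p * (c ! j - c ! i - wrap j)"
    using allowed w by (intro mult_left_mono) (auto simp: allowed_iff i_def)
  ultimately have gap: "x c j - x c i \<ge> 2" using p by linarith
  \<comment> \<open>Compare (x_i + 1)^2 + (x_j - 1)^2 with x_i^2 + x_j^2; a gap of at least 2 makes
    the change negative.\<close>
  have "(\<Sum>k<p. (x (sc p j c) k)\<^sup>2) = (\<Sum>k<p. (x c k)\<^sup>2) - 2 * (x c j - x c i - 1)"
    by (simp only: split xi xj rest) (simp add: power2_eq_square algebra_simps)
  then have "(\<Sum>k<p. (x (sc p j c) k)\<^sup>2) < (\<Sum>k<p. (x c k)\<^sup>2)" using gap by simp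
  moreover have "0 \<le> (\<Sum>k<p. (x (sc p j c) k)\<^sup>2)" by (rule sum_nonneg) simp
  ultimately show ?thesis by (simp add: potential_def x_def)
qed

lemma scopes_stepI:
  "c \<in> cvecs p \<Longrightarrow> j < p \<Longrightarrow> allowed p w j c \<Longrightarrow> scopes_step p w c (sc p j c)"
  by (auto simp: scopes_step_def)

text \<open>Since \<open>cpred p\<close> is injective on indices, the two moves act on disjoint
  pairs of positions, so neither changes the entries that the other inspects.\<close>

lemma sc_commute_far:
  assumes p: "2 \<le> p" and c: "c \<in> cvecs p" and j: "j < p" and k: "k < p"
    and aj: "allowed p w j c" and ak: "allowed p w k c"
    and ne: "j \<noteq> k" "cpred p j \<noteq> k" "cpred p k \<noteq> j"
  shows "scopes_step p w (sc p j c) (sc p k (sc p j c))"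
    and "sc p k (sc p j c) = sc p j (sc p k c)"
proof -
  have len: "length c = p" using c by (simp add: cvecs_def)
  note nth = nth_sc p len j k cpred_less cpred_neq cpred_eq_iff
  show "scopes_step p w (sc p j c) (sc p k (sc p j c))"
    using ak ne by (intro scopes_stepI sc_in_cvecs c p j k) (auto simp: allowed_iff nth)
  show "sc p k (sc p j c) = sc p j (sc p k c)"
    by (rule nth_equalityI) (use ne in \<open>auto simp: nth\<close>)
qed

text \<open>Let i, j, k be cyclically consecutive. Up to the \<open>wrap\<close> corrections, both
  orders of moving reverse the three entries. Every intermediate move stays allowed: its gap is one
  of the two original gaps or their sum.\<close>

lemma sc_braid:
  assumes p: "2 \<le> p" and c: "c \<in> cvecs p" and j: "j < p" and k: "k < p"
    and aj: "allowed p w j c" and ak: "allowed p w k c"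
    and adj: "cpred p k = j"
  shows "\<exists>u. (scopes_step p w)\<^sup>*\<^sup>* (sc p j c) u \<and> (scopes_step p w)\<^sup>*\<^sup>* (sc p k c) u"
proof -
  have len: "length c = p" using c by (simp add: cvecs_def)
  define i where "i = cpred p j"
  have jk: "j \<noteq> k" using cpred_neq[OF p k] adj by simp
  have i: "i < p" "i \<noteq> j" using cpred_less[OF j] cpred_neq[OF p j] by (auto simp: i_def)
  have dj: "c ! j - c ! i - wrap j \<ge> int w" using aj by (simp add: allowed_iff i_def)
  have dk: "c ! k - c ! j - wrap k \<ge> int w" using ak adj by (simp add: allowed_iff)
  \<comment> \<open>The case i = k forces p = 2. The two gaps would then be opposite up to
    \<open>wrap\<close>, so both moves cannot be allowed at once.\<close>
  have ik: "i \<noteq> k"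
  proof
    assume "i = k"
    then have "wrap j + wrap k \<le> 0" using dj dk by simp
    moreover have "wrap j + wrap k \<ge> 1"
      using \<open>i = k\<close> adj j k p by (auto simp: i_def cpred_def wrap_def split: if_splits)
    ultimately show False by simp
  qed
  note nth = nth_sc p len j k i_def[symmetric] adj i
  have mem: "sc p a d \<in> cvecs p" if "a < p" "d \<in> cvecs p" for a d
    using that sc_in_cvecs p by blast
  have 1: "scopes_step p w (sc p j c) (sc p k (sc p j c))"
    using dj dk jk ik by (intro scopes_stepI mem c j k) (auto simp: allowed_iff nth)
  have 2: "scopes_step p w (sc p k (sc p j c)) (sc p j (sc p k (sc p j c)))"
    using dj dk jk ik by (intro scopes_stepI mem c j k) (auto simp: allowed_iff nth)
  have 3: "scopes_step p w (sc p k c) (sc p j (sc p k c))"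
    using dj dk jk ik by (intro scopes_stepI mem c j k) (auto simp: allowed_iff nth)
  have 4: "scopes_step p w (sc p j (sc p k c)) (sc p k (sc p j (sc p k c)))"
    using dj dk jk ik by (intro scopes_stepI mem c j k) (auto simp: allowed_iff nth)
  have "sc p j (sc p k (sc p j c)) = sc p k (sc p j (sc p k c))"
    by (rule nth_equalityI) (use jk ik in \<open>auto simp: nth\<close>)
  then show ?thesis using 1 2 3 4
    by (metis converse_rtranclp_into_rtranclp r_into_rtranclp)
qed

lemma scopes_step_locally_confluent:
  assumes p: "2 \<le> p" and "scopes_step p w c d" "scopes_step p w c e"
  shows "\<exists>u. (scopes_step p w)\<^sup>*\<^sup>* d u \<and> (scopes_step p w)\<^sup>*\<^sup>* e u"
proof -
  obtain j k where c: "c \<in> cvecs p" and j: "j < p" "allowed p w j c" "d = sc p j c"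
    and k: "k < p" "allowed p w k c" "e = sc p k c"
    using assms(2,3) by (auto simp: scopes_step_def)
  consider "j = k" | "cpred p k = j" | "cpred p j = k"
    | "j \<noteq> k" "cpred p j \<noteq> k" "cpred p k \<noteq> j" by blast
  then show ?thesis
  proof cases
    case 1
    then show ?thesis using j k by blast
  next
    case 2
    then show ?thesis using sc_braid[OF p c] j k by blast
  next
    case 3
    then show ?thesis using sc_braid[OF p c] j k by blast
  next
    case 4
    then show ?thesis
      using sc_commute_far[OF p c j(1) k(1) j(2) k(2)] sc_commute_far[OF p c k(1) j(1) k(2) j(2)] j k
      by (metis r_into_rtranclp)
  qed
qed

definition reduced_vecs :: "nat \<Rightarrow> nat \<Rightarrow> int \<Rightarrow> int list set" where
  "reduced_vecs p w s =
     {c. length c = p \<and> sum_list c = s \<and> (\<forall>j<p. \<not> allowed p w j c)}"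

lemma card_scopes_families_eq_reduced:
  assumes p: "2 \<le> p" and w: "1 \<le> w"
  shows "card (scopes_families p w) = card (reduced_vecs p w 0)"
proof -
  let ?R = "scopes_equiv p w"
  have dec: "potential p d < potential p c" if "scopes_step p w c d" for c d
    using that potential_sc_less[OF p w] by (auto simp: scopes_step_def cvecs_def)
  note peak = scopes_step_locally_confluent[OF p]
  \<comment> \<open>Membership in \<open>cvecs p\<close> must be stated: no step starts outside it,
    so every list there is trivially a normal form.\<close>
  have nf: "c \<in> reduced_vecs p w 0 \<longleftrightarrow> c \<in> cvecs p \<and> normal_form (scopes_step p w) c" for c
    by (auto simp: reduced_vecs_def normal_form_def scopes_step_def cvecs_def)
  have "bij_betw (\<lambda>c. ?R `` {c}) (reduced_vecs p w 0) (scopes_families p w)"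
    unfolding bij_betw_def
  proof
    show "inj_on (\<lambda>c. ?R `` {c}) (reduced_vecs p w 0)"
    proof (rule inj_onI)
      fix c d assume c: "c \<in> reduced_vecs p w 0" and d: "d \<in> reduced_vecs p w 0"
        and eq: "?R `` {c} = ?R `` {d}"
      have "(c, d) \<in> ?R"
        using eq c d equiv_scopes_equiv[of p w] by (auto simp: eq_equiv_class_iff nf)
      then have "equivclp (scopes_step p w) c d" by (simp add: scopes_equiv_def)
      then show "c = d"
        by (rule newman_equivclp_normal_forms[of "scopes_step p w" "potential p", rotated 2])
          (use c d nf dec peak in blast)+
    qed
    show "(\<lambda>c. ?R `` {c}) ` reduced_vecs p w 0 = scopes_families p w"
    proof (intro equalityI subsetI)
      fix A assume "A \<in> (\<lambda>c. ?R `` {c}) ` reduced_vecs p w 0"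
      then show "A \<in> scopes_families p w"
        by (auto simp: scopes_families_def nf intro: quotientI)
    next
      fix A assume "A \<in> scopes_families p w"
      then obtain c where c: "c \<in> cvecs p" "A = ?R `` {c}"
        by (auto simp: scopes_families_def elim: quotientE)
      obtain n where n: "(scopes_step p w)\<^sup>*\<^sup>* c n" "normal_form (scopes_step p w) n"
        using newman_unique_normal_form[of "scopes_step p w" "potential p" c] dec peak by blast
      have "n \<in> cvecs p" using n(1) c(1)
        by (induction rule: rtranclp_induct) (auto simp: scopes_step_def intro: sc_in_cvecs[OF _ p])
      moreover have "equivclp (scopes_step p w) c n"
        using n(1) by (rule rtranclp_into_equivclp)
      ultimately have "(c, n) \<in> ?R" "n \<in> reduced_vecs p w 0"
        using c n(2) by (auto simp: scopes_equiv_def nf)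
      then show "A \<in> (\<lambda>c. ?R `` {c}) ` reduced_vecs p w 0"
        using equiv_class_eq[OF equiv_scopes_equiv] c(2) by blast
    qed
  qed
  then show ?thesis by (metis bij_betw_same_card)
qed

section \<open>Counting irreducible vectors\<close>

text \<open>The bijection is the cyclic shift \<open>?f\<close>. Adding one to the entry that passes
  from the end to the front makes the \<open>wrap\<close> terms cancel, so allowedness at
  \<open>j\<close> after the shift is allowedness at \<open>cpred p j\<close> before it.\<close>

lemma card_reduced_vecs_Suc:
  assumes p: "2 \<le> p"
  shows "card (reduced_vecs p w (s + 1)) = card (reduced_vecs p w s)"
proof -
  let ?f = "\<lambda>c :: int list. (last c + 1) # butlast c"
  let ?g = "\<lambda>c :: int list. tl c @ [hd c - 1]"
  have nth_f: "?f c ! i = c ! cpred p i + wrap i" if "length c = p" "i < p" for c i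
    using that p last_conv_nth[of c]
    by (cases i) (fastforce simp: cpred_def wrap_def nth_butlast)+
  have allowed_f: "allowed p w j (?f c) \<longleftrightarrow> allowed p w (cpred p j) c"
    if "length c = p" "j < p" for c j
    using that p nth_f[of c j] nth_f[of c "cpred p j"] cpred_less[of j p]
    by (simp add: allowed_iff algebra_simps)
  have cpred_surj: "\<exists>j<p. i = cpred p j" if "i < p" for i
    using that p by (intro exI[of _ "if i = p - 1 then 0 else i + 1"]) (auto simp: cpred_def)
  have all_f: "(\<forall>j<p. \<not> allowed p w j (?f c)) \<longleftrightarrow> (\<forall>j<p. \<not> allowed p w j c)"
    if "length c = p" for c
    using allowed_f[OF that] cpred_surj cpred_less by metis
  have sum_f: "sum_list (?f c) = sum_list c + 1" if "length c = p" for c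
    using that p by (subst (2) append_butlast_last_id[symmetric]) (auto simp del: append_butlast_last_id)
  have fg: "?f (?g c) = c" if "length c = p" for c
    using that p by (cases c) auto
  have gf: "?g (?f c) = c" if "length c = p" for c
    using that p by (cases c rule: rev_cases) auto
  have f_mem: "?f c \<in> reduced_vecs p w (s + 1) \<longleftrightarrow> c \<in> reduced_vecs p w s" if "length c = p" for c
    using that p all_f[OF that] sum_f[OF that] by (auto simp: reduced_vecs_def)
  have "bij_betw ?f (reduced_vecs p w s) (reduced_vecs p w (s + 1))"
  proof (rule bij_betw_byWitness[where f' = ?g])
    show "\<forall>c\<in>reduced_vecs p w s. ?g (?f c) = c" using gf by (simp add: reduced_vecs_def)
    show "\<forall>c\<in>reduced_vecs p w (s + 1). ?f (?g c) = c" using fg by (simp add: reduced_vecs_def)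
    show "?f ` reduced_vecs p w s \<subseteq> reduced_vecs p w (s + 1)"
    proof
      fix d assume "d \<in> ?f ` reduced_vecs p w s"
      then obtain c where c: "c \<in> reduced_vecs p w s" "d = ?f c" by blast
      then have "length c = p" by (simp add: reduced_vecs_def)
      then show "d \<in> reduced_vecs p w (s + 1)" using f_mem c by blast
    qed
    show "?g ` reduced_vecs p w (s + 1) \<subseteq> reduced_vecs p w s"
    proof
      fix d assume "d \<in> ?g ` reduced_vecs p w (s + 1)"
      then obtain c where c: "c \<in> reduced_vecs p w (s + 1)" "d = ?g c" by blast
      then have len: "length c = p" by (simp add: reduced_vecs_def)
      then have "length d = p" using c(2) p by simp
      then show "d \<in> reduced_vecs p w s" using f_mem[of d] fg[OF len] c by simp
    qed
  qed
  then show ?thesis by (metis bij_betw_same_card)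
qed

text \<open>On reduced vectors the conversion \<open>nat\<close> truncates nothing: an index is not
  allowed exactly when the integer inside is nonnegative.\<close>

definition slack :: "nat \<Rightarrow> nat \<Rightarrow> int list \<Rightarrow> nat list" where
  "slack p w c = map (\<lambda>j. nat (int w - 1 + wrap j - (c ! j - c ! cpred p j))) [0..<p]"

text \<open>Around the cycle the differences cancel and the \<open>wrap\<close> terms add up to 1,
  which gives the total p(w - 1) + 1. Conversely, slacks determine the differences, hence the vector
  up to a constant; adding a constant changes the sum by a multiple of p, so the window of sums from
  0 to p - 1 picks out one vector.\<close>

lemma bij_betw_slack:
  assumes p: "2 \<le> p" and w: "1 \<le> w"
  shows "bij_betw (slack p w) (\<Union>s<p. reduced_vecs p w (int s))
           {e. length e = p \<and> sum_list e = p * (w - 1) + 1}"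
    (is "bij_betw _ ?M ?E")
proof -
  have sum_wrap: "(\<Sum>j<p. wrap j) = 1"
    using p by (simp add: wrap_def sum.delta)
  have sum_cpred: "(\<Sum>j<p. f (cpred p j)) = (\<Sum>j<p. f j)" for f :: "nat \<Rightarrow> int"
  proof (rule sum.reindex_bij_betw)
    show "bij_betw (cpred p) {..<p} {..<p}"
      unfolding bij_betw_def
      using endo_inj_surj[of "{..<p}" "cpred p"] cpred_less cpred_eq_iff
      by (auto simp: inj_on_def)
  qed
  have slack_nth: "int (slack p w c ! j) = int w - 1 + wrap j - (c ! j - c ! cpred p j)"
    if "c \<in> ?M" "j < p" for c j
    using that by (auto simp: slack_def reduced_vecs_def allowed_iff)
  have sum_nth: "sum_list c = (\<Sum>j<p. c ! j)" if "length c = p" for c :: "int list"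
    using that by (simp add: sum_list_sum_nth atLeast0LessThan)
  show ?thesis
    unfolding bij_betw_def
  proof
    show "inj_on (slack p w) ?M"
    proof (rule inj_onI)
      fix c d assume c: "c \<in> ?M" and d: "d \<in> ?M" and eq: "slack p w c = slack p w d"
      have len: "length c = p" "length d = p" using c d by (auto simp: reduced_vecs_def)
      have diff: "c ! j - c ! cpred p j = d ! j - d ! cpred p j" if "j < p" for j
        using slack_nth[OF c that] slack_nth[OF d that] eq by simp
      have const: "c ! j - d ! j = c ! 0 - d ! 0" if "j < p" for j
        using that
      proof (induction j)
        case (Suc j)
        then show ?case using diff[of "Suc j"] by (simp add: cpred_def)
      qed simp
      have "sum_list c - sum_list d = int p * (c ! 0 - d ! 0)"
      proof -
        have "sum_list c - sum_list d = (\<Sum>j<p. c ! j - d ! j)"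
          by (simp add: sum_nth len sum_subtractf)
        also have "\<dots> = (\<Sum>j<p. c ! 0 - d ! 0)" by (intro sum.cong refl const) simp
        finally show ?thesis by simp
      qed
      moreover have "\<bar>sum_list c - sum_list d\<bar> < int p"
        using c d by (auto simp: reduced_vecs_def)
      ultimately have "int p * \<bar>c ! 0 - d ! 0\<bar> < int p * 1" by (simp add: abs_mult)
      then have "c ! 0 - d ! 0 = 0" by (subst (asm) mult_less_cancel_left_pos) (use p in auto)
      then have "c ! j = d ! j" if "j < p" for j using const[OF that] by simp
      then show "c = d" using len by (intro nth_equalityI) auto
    qed
    show "slack p w ` ?M = ?E"
    proof (intro equalityI subsetI)
      fix e assume "e \<in> slack p w ` ?M"
      then obtain c where c: "c \<in> ?M" "e = slack p w c" by blast
      have len: "length e = p" by (simp add: c slack_def)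
      have "int (sum_list e) = (\<Sum>j<p. int (e ! j))"
        using len by (simp add: sum_list_sum_nth atLeast0LessThan)
      also have "\<dots> = (\<Sum>j<p. int w - 1 + wrap j - (c ! j - c ! cpred p j))"
        using slack_nth c by simp
      also have "\<dots> = int p * (int w - 1) + 1"
        using sum_cpred[of "\<lambda>j. c ! j"] by (simp add: sum_subtractf sum.distrib sum_wrap)
      also have "\<dots> = int (p * (w - 1) + 1)" using w by (simp add: of_nat_diff)
      finally show "e \<in> ?E" using len by (simp only: of_nat_eq_iff mem_Collect_eq)
    next
      fix e assume "e \<in> ?E"
      then have len: "length e = p" and sum: "sum_list e = p * (w - 1) + 1" by auto
      \<comment> \<open>Solves the difference equations at the indices 1, ..., p - 1 from the start
        value 0.\<close>
      define b where "b j = (\<Sum>i\<in>{1..j}. int w - 1 - int (e ! i))" for j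
      define S where "S = (\<Sum>j<p. b j)"
      \<comment> \<open>This constant shift reduces the sum \<open>S\<close> to its remainder modulo
        p.\<close>
      define c where "c = map (\<lambda>j. b j - S div int p) [0..<p]"
      have len_c: "length c = p" by (simp add: c_def)
      have "sum_list c = S - int p * (S div int p)"
        by (simp add: sum_nth len_c) (simp add: c_def S_def sum_subtractf)
      then have sum_c: "sum_list c = S mod int p" by (simp add: minus_mult_div_eq_mod)
      \<comment> \<open>The remaining equation, at index 0, is not built into \<open>b\<close>; it
        follows from the prescribed total of \<open>e\<close>.\<close>
      have b_last: "b 0 - b (p - 1) = int w - int (e ! 0)"
      proof -
        have "{..<p} = insert 0 {1..p-1}" using p by auto
        then have "int (sum_list e) = int (e ! 0) + (\<Sum>i\<in>{1..p-1}. int (e ! i))"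
          using len by (simp add: sum_list_sum_nth atLeast0LessThan)
        moreover have "int (sum_list e) = int p * (int w - 1) + 1"
          using sum w by (simp add: of_nat_diff)
        moreover have "b (p - 1) = (int p - 1) * (int w - 1) - (\<Sum>i\<in>{1..p-1}. int (e ! i))"
          using p by (simp add: b_def sum_subtractf of_nat_diff)
        ultimately show ?thesis by (simp add: b_def algebra_simps)
      qed
      have e_nth: "int w - 1 + wrap j - (c ! j - c ! cpred p j) = int (e ! j)" if "j < p" for j
      proof (cases j)
        case 0
        then show ?thesis using b_last p by (simp add: c_def cpred_def wrap_def)
      next
        case (Suc i)
        then show ?thesis using that by (simp add: c_def cpred_def wrap_def b_def)
      qed
      have "\<not> allowed p w j c" if "j < p" for j
        using e_nth[OF that] by (simp add: allowed_iff)
      moreover obtain s where s: "s < p" "int s = S mod int p"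
        using p by (intro that[of "nat (S mod int p)"]) (auto simp: nat_less_iff)
      ultimately have "c \<in> reduced_vecs p w (int s)"
        using len_c sum_c by (simp add: reduced_vecs_def)
      then have "c \<in> ?M" using s(1) by blast
      moreover have "slack p w c = e"
        by (rule nth_equalityI) (auto simp: slack_def len e_nth)
      ultimately show "e \<in> slack p w ` ?M" by blast
    qed
  qed
qed

lemma card_reduced_vecs:
  assumes p: "2 \<le> p" and w: "1 \<le> w"
  shows "p * card (reduced_vecs p w 0) = (p * w) choose (p - 1)"
proof -
  let ?E = "{e :: nat list. length e = p \<and> sum_list e = p * (w - 1) + 1}"
  have pw: "p * (w - 1) + p = p * w" using w by (cases w) auto
  have card_E: "card ?E = (p * w) choose (p - 1)"
  proof -
    \<comment> \<open>Stars and bars; the lower index equals pw - (p - 1), so symmetry of binomials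
      finishes the count.\<close>
    have "card ?E = (p * (w - 1) + 1 + p - 1) choose (p * (w - 1) + 1)"
      by (rule card_length_sum_list)
    also have "\<dots> = (p * w) choose (p * w - (p - 1))"
      using pw p by (intro arg_cong2[where f = binomial]) auto
    also have "\<dots> = (p * w) choose (p - 1)"
      using pw p by (intro binomial_symmetric[symmetric]) linarith
    finally show ?thesis .
  qed
  have "p - 1 \<le> p * w" using pw by linarith
  \<comment> \<open>Infinite sets have \<open>card\<close> 0, so a positive count yields the
    finiteness required for splitting the union by sums.\<close>
  then have "card ?E > 0" by (simp only: card_E zero_less_binomial_iff)
  then have fin_E: "finite ?E" using card_ge_0_finite by blast
  have fin: "finite (\<Union>s<p. reduced_vecs p w (int s))"
    using bij_betw_finite[OF bij_betw_slack[OF p w]] fin_E by blast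
  have level: "card (reduced_vecs p w (int s)) = card (reduced_vecs p w 0)" for s
  proof (induction s)
    case (Suc s)
    then show ?case using card_reduced_vecs_Suc[OF p, of w "int s"] by (simp add: add.commute)
  qed simp
  have "card ?E = card (\<Union>s<p. reduced_vecs p w (int s))"
    using bij_betw_same_card[OF bij_betw_slack[OF p w]] by simp
  also have "\<dots> = (\<Sum>s<p. card (reduced_vecs p w (int s)))"
    using fin by (intro card_UN_disjoint) (auto simp: reduced_vecs_def)
  also have "\<dots> = p * card (reduced_vecs p w 0)" by (simp add: level)
  finally show ?thesis using card_E by simp
qed

theorem theorem4p12:
  fixes p w :: nat
  assumes "prime p" and "w \<ge> 1"
  shows "real (card (scopes_families p w)) = 1 / real p * real ((p * w) choose (p - 1))"
proof -
  have p: "2 \<le> p" using assms(1) by (rule prime_ge_2_nat)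
  have "real p * real (card (scopes_families p w)) = real ((p * w) choose (p - 1))"
    using card_reduced_vecs[OF p assms(2)] card_scopes_families_eq_reduced[OF p assms(2)]
    by (metis of_nat_mult)
  then show ?thesis using p by (simp add: field_simps)
qed

end
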